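(* Let $q\ge1$ be an integer, $\beta,J$ constants with $\mathrm{e}^{\beta J}\neq1$, and $\boldsymbol{B}=(B_1,\dots,B_q)\in\mathbb{C}^q$. Let $G$ be a finite graph with the magnetic field vector $\boldsymbol{B}$ at every vertex, and let $Z(G)=\sum_\sigma\mathrm{e}^{-\beta h(\sigma)}$ with \[h(\sigma)=-J\sum_{\{v_i,v_j\}\in E(G)}\delta(\sigma_i,\sigma_j)-\sum_{v_i\in V(G)}\sum_{\alpha=1}^q B_\alpha\,\delta(\alpha,\sigma_i).\] Then \[Z(G)=(\mathrm{e}^{\beta J}-1)^{|V(G)|}\,U\big(G;\{x_k\}_{k\in\mathbb{Z}^+},\mathrm{e}^{\beta J}\big),\qquad x_k=\frac{1}{\mathrm{e}^{\beta J}-1}\sum_{\alpha=1}^q\mathrm{e}^{\beta kB_\alpha}.\]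
   Context: Graphs are finite, loops and multiple edges allowed. A state is a map $\sigma:V(G)\to\{1,\dots,q\}$, $\sigma_i=\sigma(v_i)$; $Z$ sums over all states; $\delta$ is the Kronecker delta. Noble and Welsh's $W$-polynomial $W(G,\omega;\boldsymbol{x},y)$ of a graph with vertex weights $\omega:V(G)\to\mathbb{Z}^+$ and variables $\boldsymbol{x}=\{x_k\}_{k\in\mathbb{Z}^+},y$ is defined recursively by: for a non-loop edge $e$, $W(G)=W(G-e)+W(G/e)$; for a loop $e$, $W(G)=yW(G-e)$; for $m$ isolated vertices of weights $\omega_1,\dots,\omega_m$, $W=\prod x_{\omega_i}$; here $G-e$ deletes $e$, weights unchanged, and $G/e$ contracts a non-loop edge, the merged vertex receiving the sum of the two endpoint weights. The $U$-polynomial of an unweighted graph $G$ is $U(G;\boldsymbol{x},y)=W(G,\omega;\boldsymbol{x},y)$ with $\omega(v)=1$ for all vertices $v$. *)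

theory Defs
  imports Complex_Main "HOL-Library.FuncSet" "HOL-Library.Uprod" "HOL-Library.Poly_Mapping"
begin

section \<open>Finite graphs with loops and multiple edges\<close>

text \<open>An edge is a name carrying an unordered pair of end vertices, so parallel edges are
  distinct names with the same ends. An edge is a loop iff its pair of ends is not proper,
  i.e. iff it has the form \<open>Upair v v\<close>. The values of \<open>ends\<close> outside \<open>edges\<close> are irrelevant.\<close>

record ('v, 'e) multigraph =
  verts :: "'v set"
  edges :: "'e set"
  ends :: "'e \<Rightarrow> 'v uprod"

definition finite_graph :: "('v, 'e) multigraph \<Rightarrow> bool" where
  "finite_graph G \<longleftrightarrow> finite (verts G) \<and> finite (edges G) \<and>
     (\<forall>e\<in>edges G. set_uprod (ends G e) \<subseteq> verts G)"

definition delete_edge :: "'e \<Rightarrow> ('v, 'e) multigraph \<Rightarrow> ('v, 'e) multigraph" where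
  "delete_edge e G = G\<lparr>edges := edges G - {e}\<rparr>"

text \<open>Contraction of an edge \<open>e\<close> with distinct ends \<open>u\<close> and \<open>v\<close>; the merged vertex is
  called \<open>u\<close>.\<close>

definition contract_edge :: "'e \<Rightarrow> 'v \<Rightarrow> 'v \<Rightarrow> ('v, 'e) multigraph \<Rightarrow> ('v, 'e) multigraph" where
  "contract_edge e u v G =
     \<lparr>verts = verts G - {v}, edges = edges G - {e},
      ends = (\<lambda>f. map_uprod (id(v := u)) (ends G f))\<rparr>"

definition contract_weight :: "'v \<Rightarrow> 'v \<Rightarrow> ('v \<Rightarrow> nat) \<Rightarrow> 'v \<Rightarrow> nat" where
  "contract_weight u v \<omega> = \<omega>(u := \<omega> u + \<omega> v)"

section \<open>Integer polynomials in \<open>x\<^sub>1, x\<^sub>2, \<dots>\<close> and \<open>y\<close>\<close>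

datatype wvar = X nat | Y

text \<open>A monomial is a finitely supported exponent vector, a polynomial a finitely supported
  family of coefficients indexed by monomials; the ring operations are those of
  \<open>Poly_Mapping\<close>.\<close>

type_synonym wpoly = "(wvar \<Rightarrow>\<^sub>0 nat) \<Rightarrow>\<^sub>0 int"

definition wVar :: "wvar \<Rightarrow> wpoly" where
  "wVar t = Poly_Mapping.single (Poly_Mapping.single t 1) 1"

definition eval_wpoly :: "(nat \<Rightarrow> 'a) \<Rightarrow> 'a \<Rightarrow> wpoly \<Rightarrow> 'a::comm_ring_1" where
  "eval_wpoly x y p =
     (\<Sum>m\<in>Poly_Mapping.keys p. of_int (Poly_Mapping.lookup p m) *
        (\<Prod>t\<in>Poly_Mapping.keys m.
           (case t of X k \<Rightarrow> x k | Y \<Rightarrow> y) ^ Poly_Mapping.lookup m t))"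

section \<open>The \<open>W\<close>- and \<open>U\<close>-polynomials of Noble and Welsh\<close>

text \<open>\<open>W_value G \<omega> p\<close>: some run of the recursion on the weighted graph \<open>(G, \<omega>)\<close> yields \<open>p\<close>.
  Both the order of the edges and the name of a merged vertex are left open: since
  \<open>Upair u v = Upair v u\<close>, a contraction may keep either end. The variable \<open>X 0\<close> does not
  occur if all weights are positive.\<close>

inductive W_value :: "('v, 'e) multigraph \<Rightarrow> ('v \<Rightarrow> nat) \<Rightarrow> wpoly \<Rightarrow> bool" where
  isolated: "W_value G \<omega> (\<Prod>v\<in>verts G. wVar (X (\<omega> v)))"
    if "edges G = {}"
| nonloop: "W_value G \<omega> (p + r)"
    if "e \<in> edges G" "ends G e = Upair u v" "u \<noteq> v"
       "W_value (delete_edge e G) \<omega> p"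
       "W_value (contract_edge e u v G) (contract_weight u v \<omega>) r"
| loop: "W_value G \<omega> (wVar Y * p)"
    if "e \<in> edges G" "ends G e = Upair v v" "W_value (delete_edge e G) \<omega> p"

text \<open>For finite graphs the result does not depend on the run (Noble and Welsh).\<close>

definition W_poly :: "('v, 'e) multigraph \<Rightarrow> ('v \<Rightarrow> nat) \<Rightarrow> wpoly" where
  "W_poly G \<omega> = (THE p. W_value G \<omega> p)"

definition U_poly :: "('v, 'e) multigraph \<Rightarrow> wpoly" where
  "U_poly G = W_poly G (\<lambda>_. 1)"

section \<open>The Potts model in an external field\<close>

definition states :: "nat \<Rightarrow> ('v, 'e) multigraph \<Rightarrow> ('v \<Rightarrow> nat) set" where
  "states q G = verts G \<rightarrow>\<^sub>E {1..q}"

definition edge_delta :: "('v \<Rightarrow> nat) \<Rightarrow> 'v uprod \<Rightarrow> complex" where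
  "edge_delta \<sigma> a = of_bool (\<not> proper_uprod (map_uprod \<sigma> a))"

lemma edge_delta_Upair: "edge_delta \<sigma> (Upair u v) = of_bool (\<sigma> u = \<sigma> v)"
  by (simp add: edge_delta_def)

definition hamiltonian ::
    "nat \<Rightarrow> complex \<Rightarrow> (nat \<Rightarrow> complex) \<Rightarrow> ('v, 'e) multigraph \<Rightarrow> ('v \<Rightarrow> nat) \<Rightarrow> complex" where
  "hamiltonian q J B G \<sigma> =
     - J * (\<Sum>e\<in>edges G. edge_delta \<sigma> (ends G e))
     - (\<Sum>v\<in>verts G. \<Sum>\<alpha>=1..q. B \<alpha> * of_bool (\<alpha> = \<sigma> v))"

definition partition_function ::
    "nat \<Rightarrow> complex \<Rightarrow> complex \<Rightarrow> (nat \<Rightarrow> complex) \<Rightarrow> ('v, 'e) multigraph \<Rightarrow> complex" where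
  "partition_function q \<beta> J B G = (\<Sum>\<sigma>\<in>states q G. exp (- \<beta> * hamiltonian q J B G \<sigma>))"

end

(* Both sides obey the same deletion-contraction recursion.  In the state sum, the factor
   1 + t * delta of a non-loop edge, with t = exp (beta J) - 1, splits it into the sum for the deletion
   and t times the sum for the contraction.  The recursion for W gives the same rule for t ^ |V| * W,
   since a contraction loses exactly one vertex.

   W is well defined because (y - 1) ^ |V| * W equals the subset expansion
   SUM A. (y - 1) ^ |A| * PROD C. (y - 1) * x (weight of C), where C ranges over the components of
   (V, A): this does not depend on a run, and y - 1 can be cancelled. *)

theory Submission
  imports Defs
begin

section \<open>The polynomial ring\<close>

text \<open>An arbitrary linear order, needed only to make \<open>wpoly\<close> an integral domain.\<close>

instantiation wvar :: linorder
begin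

definition less_eq_wvar :: "wvar \<Rightarrow> wvar \<Rightarrow> bool" where
  "less_eq_wvar s t \<longleftrightarrow> case_wvar Suc 0 s \<le> case_wvar Suc 0 t"

definition less_wvar :: "wvar \<Rightarrow> wvar \<Rightarrow> bool" where
  "less_wvar s t \<longleftrightarrow> case_wvar Suc 0 s < case_wvar Suc 0 t"

instance
  by standard (auto simp: less_eq_wvar_def less_wvar_def split: wvar.splits)

end

text \<open>The coefficients at the constant monomial are 0 and 1. This makes
  \<open>wVar Y - 1\<close> cancellable in the integral domain \<open>wpoly\<close>.\<close>

lemma wVar_neq_one: "wVar t \<noteq> 1"
proof
  assume "wVar t = 1"
  then have "Poly_Mapping.lookup (wVar t) 0 = Poly_Mapping.lookup 1 0" by simp
  moreover have "Poly_Mapping.single t (1::nat) \<noteq> 0"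
    by (metis lookup_single_eq lookup_zero one_neq_zero)
  ultimately show False by (simp add: wVar_def lookup_single lookup_one)
qed

section \<open>Evaluation as a ring homomorphism\<close>

definition eval_monom :: "(nat \<Rightarrow> 'a) \<Rightarrow> 'a \<Rightarrow> (wvar \<Rightarrow>\<^sub>0 nat) \<Rightarrow> 'a::comm_ring_1" where
  "eval_monom x y m =
     (\<Prod>t\<in>Poly_Mapping.keys m. (case t of X k \<Rightarrow> x k | Y \<Rightarrow> y) ^ Poly_Mapping.lookup m t)"

text \<open>Extra variables have exponent 0 and contribute the factor 1, so two monomials can be
  evaluated over a common index set.\<close>

lemma eval_monom_superset:
  assumes "finite T" "Poly_Mapping.keys m \<subseteq> T"
  shows "eval_monom x y m = (\<Prod>t\<in>T. (case t of X k \<Rightarrow> x k | Y \<Rightarrow> y) ^ Poly_Mapping.lookup m t)"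
  unfolding eval_monom_def
  by (rule prod.mono_neutral_left) (use assms in \<open>auto simp: in_keys_iff\<close>)

lemma eval_monom_add: "eval_monom x y (m + n) = eval_monom x y m * eval_monom x y n"
proof -
  let ?T = "Poly_Mapping.keys m \<union> Poly_Mapping.keys n"
  have "Poly_Mapping.keys (m + n) \<subseteq> ?T" by (rule Poly_Mapping.keys_add)
  then show ?thesis
    by (simp add: eval_monom_superset[of ?T] lookup_add power_add prod.distrib)
qed

lemma eval_wpoly_monom:
  "eval_wpoly x y p =
     (\<Sum>m\<in>Poly_Mapping.keys p. of_int (Poly_Mapping.lookup p m) * eval_monom x y m)"
  by (simp add: eval_wpoly_def eval_monom_def)

lemma eval_wpoly_add: "eval_wpoly x y (p + r) = eval_wpoly x y p + eval_wpoly x y r"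
  unfolding eval_wpoly_monom
  by (rule setsum_keys_plus_distrib[where f = "\<lambda>m c. of_int c * eval_monom x y m"])
    (simp_all add: algebra_simps)

lemma eval_wpoly_zero: "eval_wpoly x y 0 = 0"
  by (simp add: eval_wpoly_def)

lemma eval_wpoly_single: "eval_wpoly x y (Poly_Mapping.single m c) = of_int c * eval_monom x y m"
  by (simp add: eval_wpoly_monom)

lemma wpoly_induct [case_names zero add_single]:
  fixes p :: wpoly
  assumes "P 0" "\<And>p m c. P p \<Longrightarrow> P (p + Poly_Mapping.single m c)"
  shows "P p"
proof (induction p rule: update_induct)
  case const
  show ?case by (rule assms(1))
next
  case (update p m c)
  \<comment> \<open>\<open>m\<close> lies outside the support of \<open>p\<close>, so overwriting
    its coefficient amounts to adding a term.\<close>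
  have "Poly_Mapping.update m c p = p + Poly_Mapping.single m c"
    by (rule poly_mapping_eqI)
      (use update.hyps in \<open>auto simp: lookup_update lookup_add lookup_single in_keys_iff when_def\<close>)
  with assms(2)[OF update.IH] show ?case by simp
qed

text \<open>By additivity, induction on both factors reduces the claim to a product of two single
  terms, where exponents add.\<close>

lemma eval_wpoly_mult: "eval_wpoly x y (p * r) = eval_wpoly x y p * eval_wpoly x y r"
proof (induction p rule: wpoly_induct)
  case zero
  show ?case by (simp add: eval_wpoly_zero)
next
  case (add_single p m c)
  have "eval_wpoly x y (Poly_Mapping.single m c * r) =
      eval_wpoly x y (Poly_Mapping.single m c) * eval_wpoly x y r"
    by (induction r rule: wpoly_induct)
      (simp_all add: eval_wpoly_zero eval_wpoly_add distrib_left mult_single eval_wpoly_single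
        eval_monom_add mult_ac)
  with add_single show ?case by (simp add: distrib_right eval_wpoly_add)
qed

lemma eval_wpoly_one: "eval_wpoly x y 1 = 1"
  using eval_wpoly_single[of x y 0 1] by (simp add: eval_monom_def)

lemma eval_wpoly_wVar: "eval_wpoly x y (wVar t) = (case t of X k \<Rightarrow> x k | Y \<Rightarrow> y)"
  by (simp add: wVar_def eval_wpoly_single eval_monom_def)

section \<open>Deletion and contraction\<close>

lemma finite_graph_delete: "finite_graph G \<Longrightarrow> finite_graph (delete_edge e G)"
  by (auto simp: finite_graph_def delete_edge_def)

lemma finite_graph_contract:
  assumes "finite_graph G" "e \<in> edges G" "ends G e = Upair u v" "u \<noteq> v"
  shows "finite_graph (contract_edge e u v G)"
proof -
  have "u \<in> verts G" using assms by (force simp: finite_graph_def)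
  with assms show ?thesis
    by (fastforce simp: finite_graph_def contract_edge_def uprod.set_map)
qed

lemma W_value_exists:
  assumes "finite_graph G"
  shows "\<exists>p. W_value G \<omega> p"
  using assms
\<comment> \<open>Deletion and contraction both remove exactly one edge; the weights are generalised
  because a contraction changes them.\<close>
proof (induction "card (edges G)" arbitrary: G \<omega>)
  case 0
  then have "edges G = {}" by (simp add: finite_graph_def)
  then show ?case using W_value.isolated by blast
next
  case (Suc n)
  then obtain e where e: "e \<in> edges G" by fastforce
  obtain u v where uv: "ends G e = Upair u v" by (cases "ends G e")
  have card: "card (edges G - {e}) = n" using Suc e by simp
  obtain p where p: "W_value (delete_edge e G) \<omega> p"
    using Suc.hyps(1)[of "delete_edge e G"] card finite_graph_delete[OF Suc.prems]
    by (auto simp: delete_edge_def)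
  show ?case
  proof (cases "u = v")
    case True
    then show ?thesis using W_value.loop[OF e _ p] uv by blast
  next
    case False
    obtain r where "W_value (contract_edge e u v G) (contract_weight u v \<omega>) r"
      using Suc.hyps(1)[of "contract_edge e u v G"] card
        finite_graph_contract[OF Suc.prems e uv False]
      by (auto simp: contract_edge_def)
    then show ?thesis using W_value.nonloop[OF e uv False p] by blast
  qed
qed

text \<open>Stated for an arbitrary ring homomorphism \<open>h\<close> because it serves twice: with
  the identity and the subset expansion for uniqueness of W, and with an evaluation and the state
  sum for the formula. \<open>t\<close> is the image of \<open>y - 1\<close>.\<close>

lemma deletion_contraction_invariant:
  fixes h :: "wpoly \<Rightarrow> 'a::comm_ring_1" and F :: "('v, 'e) multigraph \<Rightarrow> ('v \<Rightarrow> nat) \<Rightarrow> 'a"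
  assumes W: "W_value G \<omega> p" and G: "finite_graph G"
    and h: "\<And>p r. h (p + r) = h p + h r" "\<And>p r. h (p * r) = h p * h r" "h 1 = 1"
      "h (wVar Y) = 1 + t"
    and F_isolated: "\<And>G \<omega>. finite_graph G \<Longrightarrow> edges G = {} \<Longrightarrow>
      F G \<omega> = (\<Prod>v\<in>verts G. t * h (wVar (X (\<omega> v))))"
    and F_nonloop: "\<And>G \<omega> e u v. finite_graph G \<Longrightarrow> e \<in> edges G \<Longrightarrow> ends G e = Upair u v \<Longrightarrow> u \<noteq> v \<Longrightarrow>
      F G \<omega> = F (delete_edge e G) \<omega> + t * F (contract_edge e u v G) (contract_weight u v \<omega>)"
    and F_loop: "\<And>G \<omega> e v. finite_graph G \<Longrightarrow> e \<in> edges G \<Longrightarrow> ends G e = Upair v v \<Longrightarrow>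
      F G \<omega> = (1 + t) * F (delete_edge e G) \<omega>"
  shows "F G \<omega> = t ^ card (verts G) * h p"
  using W G
proof (induction rule: W_value.induct)
  case (isolated G \<omega>)
  have "h (\<Prod>v\<in>S. f v) = (\<Prod>v\<in>S. h (f v))" for S :: "'v set" and f
    by (induction S rule: infinite_finite_induct) (simp_all add: h)
  then show ?case
    by (simp add: F_isolated[OF isolated.prems isolated.hyps] prod.distrib)
next
  case (nonloop e G u v \<omega> p r)
  have "v \<in> verts G" "finite (verts G)"
    using nonloop by (force simp: finite_graph_def)+
  then have "card (verts G) = Suc (card (verts (contract_edge e u v G)))"
    by (simp add: contract_edge_def card.remove del: card_Diff_insert)
  moreover have "verts (delete_edge e G) = verts G" by (simp add: delete_edge_def)
  ultimately show ?case
    using nonloop.IH(1)[OF finite_graph_delete[OF nonloop.prems]]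
      nonloop.IH(2)[OF finite_graph_contract[OF nonloop.prems nonloop.hyps(1-3)]]
    by (simp add: F_nonloop[OF nonloop.prems nonloop.hyps(1-3)] h algebra_simps)
next
  case (loop e G v \<omega> p)
  have "verts (delete_edge e G) = verts G" by (simp add: delete_edge_def)
  then show ?case
    using loop.IH[OF finite_graph_delete[OF loop.prems]]
    by (simp add: F_loop[OF loop.prems loop.hyps(1,2)] h mult_ac)
qed

section \<open>The subset expansion\<close>

text \<open>A cut that no edge of \<open>A\<close> crosses. For edges of a finite graph,
  \<open>S \<inter> verts G\<close> is then a union of components of \<open>(V, A)\<close>.\<close>

definition edge_closed :: "('v, 'e) multigraph \<Rightarrow> 'e set \<Rightarrow> 'v set \<Rightarrow> bool" where
  "edge_closed G A S \<longleftrightarrow>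
     (\<forall>e\<in>A. set_uprod (ends G e) \<subseteq> S \<or> set_uprod (ends G e) \<inter> S = {})"

text \<open>Connectedness by the edges in \<open>A\<close>, expressed by separating sets instead of paths:
  a contraction then acts by preimages.\<close>

definition connected_via :: "('v, 'e) multigraph \<Rightarrow> 'e set \<Rightarrow> 'v \<Rightarrow> 'v \<Rightarrow> bool" where
  "connected_via G A x y \<longleftrightarrow> (\<forall>S. edge_closed G A S \<longrightarrow> (x \<in> S \<longleftrightarrow> y \<in> S))"

definition component :: "('v, 'e) multigraph \<Rightarrow> 'e set \<Rightarrow> 'v \<Rightarrow> 'v set" where
  "component G A x = {y \<in> verts G. connected_via G A x y}"

text \<open>The product runs over the set of components, so each counts once, however many vertices
  represent it.\<close>

definition component_prod ::
    "'a::comm_ring_1 \<Rightarrow> (nat \<Rightarrow> 'a) \<Rightarrow> ('v, 'e) multigraph \<Rightarrow> ('v \<Rightarrow> nat) \<Rightarrow> 'e set \<Rightarrow> 'a" where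
  "component_prod t x G \<omega> A = (\<Prod>C\<in>component G A ` verts G. t * x (sum \<omega> C))"

text \<open>In Noble and Welsh's expansion y - 1 has exponent |A| - |V| + k(A), with k(A) the number
  of components. After multiplication by \<open>t ^ |V|\<close>, the factor
  \<open>t ^ card A\<close> supplies |A| and the component factors supply k(A).\<close>

definition subset_expansion ::
    "'a::comm_ring_1 \<Rightarrow> (nat \<Rightarrow> 'a) \<Rightarrow> ('v, 'e) multigraph \<Rightarrow> ('v \<Rightarrow> nat) \<Rightarrow> 'a" where
  "subset_expansion t x G \<omega> = (\<Sum>A\<in>Pow (edges G). t ^ card A * component_prod t x G \<omega> A)"

section \<open>Components under deletion and contraction\<close>

lemma connected_via_empty: "connected_via G {} x y \<longleftrightarrow> x = y"
  by (auto simp: connected_via_def edge_closed_def)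

text \<open>Components depend on the vertices, the ends and the given \<open>A\<close> only; the
  field \<open>edges\<close> is never read.\<close>

lemma component_prod_delete: "component_prod t x (delete_edge e G) \<omega> = component_prod t x G \<omega>"
  by (simp add: fun_eq_iff component_prod_def component_def connected_via_def edge_closed_def
      delete_edge_def)

text \<open>The end set of a loop is a single point, which no set can split, so a loop puts no
  condition on separating sets.\<close>

lemma component_prod_loop:
  assumes "ends G e = Upair v v"
  shows "component_prod t x G \<omega> (insert e A) = component_prod t x G \<omega> A"
  using assms
  by (simp add: component_prod_def component_def connected_via_def edge_closed_def)

text \<open>Preimages under the map sending \<open>v\<close> to \<open>u\<close> turn the closed
  sets of the contraction into exactly the sets closed for \<open>insert e A\<close> in
  \<open>G\<close>.\<close>

lemma connected_via_contract:
  assumes "ends G e = Upair u v"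
  shows "connected_via (contract_edge e u v G) A ((id(v := u)) x) ((id(v := u)) y) \<longleftrightarrow>
    connected_via G (insert e A) x y"
proof -
  let ?\<phi> = "id(v := u)"
  have pre: "edge_closed (contract_edge e u v G) A S \<longleftrightarrow> edge_closed G A (?\<phi> -` S)" for S
  proof -
    have "?\<phi> ` T \<inter> S = {} \<longleftrightarrow> T \<inter> ?\<phi> -` S = {}" for T by blast
    then show ?thesis
      unfolding edge_closed_def contract_edge_def
      by (simp only: multigraph.simps uprod.set_map image_subset_iff_subset_vimage)
  qed
  have closed_e: "edge_closed G {e} (?\<phi> -` S)" for S
    using assms by (auto simp: edge_closed_def)
  \<comment> \<open>A set that does not separate \<open>u\<close> from \<open>v\<close> is its own
    preimage, so every set closed for \<open>insert e A\<close> arises from the contraction.\<close>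
  have saturated: "?\<phi> -` S = S" if "edge_closed G {e} S" for S
    using that assms by (auto simp: edge_closed_def split: if_splits)
  have insert: "edge_closed G (insert e A) S \<longleftrightarrow> edge_closed G {e} S \<and> edge_closed G A S" for S
    by (simp add: edge_closed_def)
  show ?thesis
    unfolding connected_via_def pre insert
    using closed_e saturated by (metis vimage_eq)
qed

text \<open>Removing \<open>v\<close> is a weight-preserving bijection from the components of
  \<open>insert e A\<close> in \<open>G\<close> to those of \<open>A\<close> in the
  contraction.\<close>

lemma component_prod_contract:
  assumes G: "finite_graph G" and e: "e \<in> edges G" and uv: "ends G e = Upair u v" "u \<noteq> v"
  shows "component_prod t x (contract_edge e u v G) (contract_weight u v \<omega>) A =
    component_prod t x G \<omega> (insert e A)"
proof -
  let ?G' = "contract_edge e u v G" and ?A' = "insert e A"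
  have V: "u \<in> verts G" "v \<in> verts G" "finite (verts G)" and V': "verts ?G' = verts G - {v}"
    using assms by (force simp: finite_graph_def contract_edge_def)+
  have uv_conn: "connected_via G ?A' w u \<longleftrightarrow> connected_via G ?A' w v" for w
    using uv by (fastforce simp: connected_via_def edge_closed_def)
  have mem: "u \<in> C \<longleftrightarrow> v \<in> C" if "C \<in> component G ?A' ` verts G" for C
    using that V uv_conn by (auto simp: component_def)
  have comp: "component ?G' A w = component G ?A' w - {v}" if "w \<in> verts G - {v}" for w
    using that connected_via_contract[OF uv(1), of A w] V'
    by (force simp: component_def)
  \<comment> \<open>\<open>v\<close> shares its component with \<open>u\<close>, so dropping
    \<open>v\<close> as a representative loses no component.\<close>
  have "component G ?A' v = component G ?A' u"
    using uv by (fastforce simp: component_def connected_via_def edge_closed_def)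
  then have "component G ?A' v \<in> component G ?A' ` (verts G - {v})"
    using V(1) uv(2) by blast
  then have "component G ?A' ` verts G = component G ?A' ` (verts G - {v})"
    using V(2) by (metis image_insert insert_Diff insert_absorb)
  then have classes: "component ?G' A ` verts ?G' = (\<lambda>C. C - {v}) ` component G ?A' ` verts G"
    using comp V' by (simp add: image_image)
  \<comment> \<open>Whether \<open>v\<close> belonged to a component can be read off from
    \<open>u\<close>, which survives.\<close>
  have inj: "inj_on (\<lambda>C. C - {v}) (component G ?A' ` verts G)"
  proof (rule inj_onI)
    fix C D
    assume CD: "C \<in> component G ?A' ` verts G" "D \<in> component G ?A' ` verts G" "C - {v} = D - {v}"
    then have "v \<in> C \<longleftrightarrow> v \<in> D" using mem uv(2) by blast
    with CD(3) show "C = D" by blast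
  qed
  \<comment> \<open>The merged vertex carries the weight of both ends, which makes up for the lost
    \<open>v\<close>.\<close>
  have weight: "sum (contract_weight u v \<omega>) (C - {v}) = sum \<omega> C"
    if C: "C \<in> component G ?A' ` verts G" for C
  proof -
    have fin: "finite C" using C V(3) by (auto simp: component_def)
    show ?thesis
    proof (cases "v \<in> C")
      case True
      then have "u \<in> C - {v}" using mem[OF C] uv(2) by simp
      then have "sum (contract_weight u v \<omega>) (C - {v}) =
          contract_weight u v \<omega> u + sum (contract_weight u v \<omega>) (C - {v} - {u})"
        using fin by (meson finite_Diff sum.remove)
      also have "sum (contract_weight u v \<omega>) (C - {v} - {u}) = sum \<omega> (C - {v} - {u})"
        by (rule sum.cong) (auto simp: contract_weight_def)
      also have "contract_weight u v \<omega> u + \<dots> = \<omega> v + (\<omega> u + sum \<omega> (C - {v} - {u}))"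
        by (simp add: contract_weight_def)
      also have "\<dots> = sum \<omega> C"
        using fin True \<open>u \<in> C - {v}\<close> by (metis finite_Diff sum.remove)
      finally show ?thesis .
    next
      case False
      then have "u \<notin> C" using mem[OF C] by simp
      with False show ?thesis by (intro sum.cong) (auto simp: contract_weight_def)
    qed
  qed
  show ?thesis
    unfolding component_prod_def classes prod.reindex[OF inj] comp_def
    by (rule prod.cong) (simp_all add: weight)
qed

section \<open>Recursion for the subset expansion\<close>

lemma subset_expansion_isolated:
  assumes "edges G = {}"
  shows "subset_expansion t x G \<omega> = (\<Prod>v\<in>verts G. t * x (\<omega> v))"
proof -
  have "component G {} v = {v}" if "v \<in> verts G" for v
    using that by (auto simp: component_def connected_via_empty)
  then have "component G {} ` verts G = (\<lambda>v. {v}) ` verts G" by simp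
  then show ?thesis
    using assms by (simp add: subset_expansion_def component_prod_def prod.reindex)
qed

text \<open>Subsets are sorted by whether they contain \<open>e\<close>; the extra edge gives the
  factor \<open>t\<close>. Loops and non-loops differ only in how the remaining sum is read.\<close>

lemma subset_expansion_split:
  assumes "finite_graph G" "e \<in> edges G"
  shows "subset_expansion t x G \<omega> = subset_expansion t x (delete_edge e G) \<omega> +
    t * (\<Sum>A\<in>Pow (edges G - {e}). t ^ card A * component_prod t x G \<omega> (insert e A))"
proof -
  let ?D = "edges G - {e}"
  have fin: "finite ?D" using assms by (simp add: finite_graph_def)
  have E: "edges G = insert e ?D" using assms by blast
  have inj: "inj_on (insert e) (Pow ?D)" by (auto simp: inj_on_def)
  have "subset_expansion t x G \<omega> = (\<Sum>A\<in>Pow ?D. t ^ card A * component_prod t x G \<omega> A) +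
      (\<Sum>A\<in>insert e ` Pow ?D. t ^ card A * component_prod t x G \<omega> A)"
    unfolding subset_expansion_def
    by (subst E, subst Pow_insert, rule sum.union_disjoint) (use fin in auto)
  also have "(\<Sum>A\<in>insert e ` Pow ?D. t ^ card A * component_prod t x G \<omega> A) =
      (\<Sum>A\<in>Pow ?D. t * (t ^ card A * component_prod t x G \<omega> (insert e A)))"
    unfolding sum.reindex[OF inj] comp_def
  proof (rule sum.cong)
    fix A
    assume "A \<in> Pow ?D"
    then have "card (insert e A) = Suc (card A)"
      using fin by (auto intro!: card_insert_disjoint intro: finite_subset)
    then show "t ^ card (insert e A) * component_prod t x G \<omega> (insert e A) =
        t * (t ^ card A * component_prod t x G \<omega> (insert e A))" by (simp add: mult_ac)
  qed simp
  also have "(\<Sum>A\<in>Pow ?D. t ^ card A * component_prod t x G \<omega> A) =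
      subset_expansion t x (delete_edge e G) \<omega>"
    unfolding subset_expansion_def component_prod_delete by (simp add: delete_edge_def)
  finally show ?thesis by (simp add: sum_distrib_left)
qed

lemma subset_expansion_nonloop:
  assumes "finite_graph G" "e \<in> edges G" "ends G e = Upair u v" "u \<noteq> v"
  shows "subset_expansion t x G \<omega> = subset_expansion t x (delete_edge e G) \<omega> +
    t * subset_expansion t x (contract_edge e u v G) (contract_weight u v \<omega>)"
proof -
  have "subset_expansion t x (contract_edge e u v G) (contract_weight u v \<omega>) =
      (\<Sum>A\<in>Pow (edges G - {e}). t ^ card A * component_prod t x G \<omega> (insert e A))"
    unfolding subset_expansion_def component_prod_contract[OF assms]
    by (simp add: contract_edge_def)
  with subset_expansion_split[OF assms(1,2)] show ?thesis by simp
qed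

lemma subset_expansion_loop:
  assumes "finite_graph G" "e \<in> edges G" "ends G e = Upair v v"
  shows "subset_expansion t x G \<omega> = (1 + t) * subset_expansion t x (delete_edge e G) \<omega>"
proof -
  have "(\<Sum>A\<in>Pow (edges G - {e}). t ^ card A * component_prod t x G \<omega> (insert e A)) =
      subset_expansion t x (delete_edge e G) \<omega>"
    unfolding subset_expansion_def component_prod_delete component_prod_loop[OF assms(3)]
    by (simp add: delete_edge_def)
  with subset_expansion_split[OF assms(1,2), of t x \<omega>] show ?thesis
    by (simp add: distrib_right)
qed

section \<open>Uniqueness of W\<close>

lemma W_value_unique:
  assumes "finite_graph G" "W_value G \<omega> p" "W_value G \<omega> r"
  shows "p = r"
proof -
  \<comment> \<open>Chosen so that \<open>wVar Y = 1 + ?t\<close>, as the invariant requires when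
    \<open>h\<close> is the identity.\<close>
  let ?t = "wVar Y - 1"
  have "subset_expansion ?t (\<lambda>k. wVar (X k)) G \<omega> = ?t ^ card (verts G) * s"
    if "W_value G \<omega> s" for s
    by (rule deletion_contraction_invariant[OF that assms(1), where h = "\<lambda>p. p"])
      (auto simp: subset_expansion_isolated intro: subset_expansion_nonloop subset_expansion_loop[where t = ?t, simplified])
  from this[OF assms(2), symmetric] this[OF assms(3)]
  have "?t ^ card (verts G) * p = ?t ^ card (verts G) * r" by (rule trans)
  then show ?thesis using wVar_neq_one[of Y] by auto
qed

lemma W_value_W_poly:
  assumes "finite_graph G"
  shows "W_value G \<omega> (W_poly G \<omega>)"
  unfolding W_poly_def
  using W_value_exists[OF assms] W_value_unique[OF assms] by (metis theI)

section \<open>The weighted state sum\<close>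

text \<open>For \<open>t = exp (\<beta> * J) - 1\<close>,
  \<open>z \<alpha> = exp (\<beta> * B \<alpha>)\<close> and unit weights this is the Boltzmann
  factor. A vertex of weight k acts as k merged spins, each keeping its own field factor.\<close>

definition state_weight ::
    "complex \<Rightarrow> (nat \<Rightarrow> complex) \<Rightarrow> ('v, 'e) multigraph \<Rightarrow> ('v \<Rightarrow> nat) \<Rightarrow> ('v \<Rightarrow> nat) \<Rightarrow> complex" where
  "state_weight t z G \<omega> \<sigma> =
     (\<Prod>e\<in>edges G. 1 + t * edge_delta \<sigma> (ends G e)) * (\<Prod>v\<in>verts G. z (\<sigma> v) ^ \<omega> v)"

definition state_sum ::
    "nat \<Rightarrow> complex \<Rightarrow> (nat \<Rightarrow> complex) \<Rightarrow> ('v, 'e) multigraph \<Rightarrow> ('v \<Rightarrow> nat) \<Rightarrow> complex" where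
  "state_sum q t z G \<omega> = (\<Sum>\<sigma>\<in>states q G. state_weight t z G \<omega> \<sigma>)"

lemma state_sum_isolated:
  assumes "finite_graph G" "edges G = {}"
  shows "state_sum q t z G \<omega> = (\<Prod>v\<in>verts G. \<Sum>\<alpha>=1..q. z \<alpha> ^ \<omega> v)"
  using assms prod_sum_PiE[of "verts G" "\<lambda>_. {1..q}" "\<lambda>v \<alpha>. z \<alpha> ^ \<omega> v"]
  by (simp add: state_sum_def state_weight_def states_def finite_graph_def)

lemma state_weight_split:
  assumes "finite_graph G" "e \<in> edges G"
  shows "state_weight t z G \<omega> \<sigma> =
    (1 + t * edge_delta \<sigma> (ends G e)) * state_weight t z (delete_edge e G) \<omega> \<sigma>"
  using assms by (simp add: state_weight_def delete_edge_def finite_graph_def prod.remove mult_ac)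

text \<open>\<open>\<tau>\<close> is left free at \<open>v\<close>, where the contraction never
  reads it, so it may be an extensional state that is \<open>undefined\<close> there.\<close>

lemma state_weight_contract:
  assumes G: "finite_graph G" and e: "e \<in> edges G" and uv: "ends G e = Upair u v" "u \<noteq> v"
    and \<sigma>: "\<sigma> u = \<sigma> v" and \<tau>: "\<And>w. w \<noteq> v \<Longrightarrow> \<tau> w = \<sigma> w"
  shows "state_weight t z (contract_edge e u v G) (contract_weight u v \<omega>) \<tau> =
    state_weight t z (delete_edge e G) \<omega> \<sigma>"
proof -
  have V: "u \<in> verts G - {v}" "v \<in> verts G" "finite (verts G)"
    using assms by (force simp: finite_graph_def)+
  \<comment> \<open>At \<open>v\<close> this reads
    \<open>\<tau> u = \<sigma> u = \<sigma> v\<close>; hence edges redirected to \<open>u\<close>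
    see the same spins as before.\<close>
  have "\<tau> \<circ> id(v := u) = \<sigma>" using \<sigma> \<tau> uv(2) by (auto simp: fun_eq_iff)
  then have delta: "edge_delta \<tau> (map_uprod (id(v := u)) a) = edge_delta \<sigma> a" for a
    by (simp add: edge_delta_def uprod.map_comp)
  have "(\<Prod>w\<in>verts G - {v}. z (\<tau> w) ^ contract_weight u v \<omega> w) =
      z (\<sigma> u) ^ (\<omega> u + \<omega> v) * (\<Prod>w\<in>verts G - {v} - {u}. z (\<sigma> w) ^ \<omega> w)"
    using V \<tau> uv(2) by (subst prod.remove[OF _ V(1)]) (auto simp: contract_weight_def intro!: prod.cong)
  also have "\<dots> = z (\<sigma> v) ^ \<omega> v *
      (z (\<sigma> u) ^ \<omega> u * (\<Prod>w\<in>verts G - {v} - {u}. z (\<sigma> w) ^ \<omega> w))"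
    by (simp add: \<sigma> power_add mult_ac)
  also have "\<dots> = (\<Prod>w\<in>verts G. z (\<sigma> w) ^ \<omega> w)"
    using V by (simp only: prod.remove[OF V(3) V(2)] prod.remove[OF finite_Diff[OF V(3)] V(1)])
  finally show ?thesis
    by (simp add: state_weight_def contract_edge_def delete_edge_def delta)
qed

text \<open>States of the contraction correspond to the states of \<open>G\<close> with equal spins
  at \<open>u\<close> and \<open>v\<close>, and the delta of \<open>e\<close> selects exactly
  these.\<close>

lemma state_sum_nonloop:
  assumes G: "finite_graph G" and e: "e \<in> edges G" and uv: "ends G e = Upair u v" "u \<noteq> v"
  shows "state_sum q t z G \<omega> = state_sum q t z (delete_edge e G) \<omega> +
    t * state_sum q t z (contract_edge e u v G) (contract_weight u v \<omega>)"
proof -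
  let ?w = "state_weight t z (delete_edge e G) \<omega>"
  let ?G' = "contract_edge e u v G"
  have V: "u \<in> verts G" "v \<in> verts G" "finite (verts G)" "verts ?G' = verts G - {v}"
    using assms by (force simp: finite_graph_def contract_edge_def)+
  have fin: "finite (states q G)" by (simp add: states_def V(3) finite_PiE)
  have "state_sum q t z ?G' (contract_weight u v \<omega>) = (\<Sum>\<sigma> | \<sigma> \<in> states q G \<and> \<sigma> u = \<sigma> v. ?w \<sigma>)"
    unfolding state_sum_def
  \<comment> \<open>One direction copies the spin of \<open>u\<close> to \<open>v\<close>; the other
    resets \<open>v\<close> to \<open>undefined\<close>, the value of extensional functions off
    their domain.\<close>
  proof (rule sum.reindex_bij_witness[where i = "\<lambda>\<sigma>. \<sigma>(v := undefined)" and j = "\<lambda>\<tau>. \<tau>(v := \<tau> u)"])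
    fix \<tau>
    assume \<tau>: "\<tau> \<in> states q ?G'"
    then have "\<tau> v = undefined"
      unfolding states_def V(4) by (rule PiE_arb) simp
    then show "(\<tau>(v := \<tau> u))(v := undefined) = \<tau>"
      by (simp add: fun_eq_iff)
    show "\<tau>(v := \<tau> u) \<in> {\<sigma> \<in> states q G. \<sigma> u = \<sigma> v}"
      using \<tau> V uv(2) by (auto simp: states_def PiE_iff extensional_def)
    show "?w (\<tau>(v := \<tau> u)) = state_weight t z ?G' (contract_weight u v \<omega>) \<tau>"
      by (rule state_weight_contract[OF assms, symmetric]) (use uv(2) in auto)
  next
    fix \<sigma>
    assume \<sigma>: "\<sigma> \<in> {\<sigma> \<in> states q G. \<sigma> u = \<sigma> v}"
    then show "(\<sigma>(v := undefined))(v := (\<sigma>(v := undefined)) u) = \<sigma>"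
      using uv(2) by (auto simp: fun_eq_iff)
    show "\<sigma>(v := undefined) \<in> states q ?G'"
      using \<sigma> V by (auto simp: states_def PiE_iff extensional_def)
  qed
  also have "\<dots> = (\<Sum>\<sigma>\<in>states q G. edge_delta \<sigma> (ends G e) * ?w \<sigma>)"
    using fin by (simp add: sum.inter_filter uv(1) edge_delta_Upair of_bool_def if_distrib cong: if_cong)
      (auto intro: sum.cong)
  finally have contract: "state_sum q t z ?G' (contract_weight u v \<omega>) =
    (\<Sum>\<sigma>\<in>states q G. edge_delta \<sigma> (ends G e) * ?w \<sigma>)" .
  have "state_sum q t z (delete_edge e G) \<omega> = (\<Sum>\<sigma>\<in>states q G. ?w \<sigma>)"
    by (simp add: state_sum_def states_def delete_edge_def)
  with contract show ?thesis
    by (simp add: state_sum_def[of q t z G] state_weight_split[OF G e] sum_distrib_left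
        sum.distrib distrib_right mult.assoc)
qed

lemma state_sum_loop:
  assumes "finite_graph G" "e \<in> edges G" "ends G e = Upair v v"
  shows "state_sum q t z G \<omega> = (1 + t) * state_sum q t z (delete_edge e G) \<omega>"
proof -
  have "states q (delete_edge e G) = states q G"
    by (simp add: states_def delete_edge_def)
  then show ?thesis
    by (simp add: state_sum_def state_weight_split[OF assms(1,2)] assms(3) edge_delta_Upair
        sum_distrib_left)
qed

text \<open>With this choice of variables, \<open>t\<close> times the k-th one is the power sum of
  \<open>z\<close>, which an isolated vertex of weight k contributes; the cancellation uses
  \<open>t \<noteq> 0\<close>.\<close>

lemma state_sum_W_poly:
  assumes "t \<noteq> 0" "finite_graph G"
  shows "state_sum q t z G \<omega> = t ^ card (verts G) *
    eval_wpoly (\<lambda>k. 1 / t * (\<Sum>\<alpha>=1..q. z \<alpha> ^ k)) (1 + t) (W_poly G \<omega>)"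
  by (rule deletion_contraction_invariant[OF W_value_W_poly[OF assms(2)] assms(2)])
    (use assms(1) in \<open>auto simp: eval_wpoly_add eval_wpoly_mult eval_wpoly_one eval_wpoly_wVar
      state_sum_isolated intro: state_sum_nonloop state_sum_loop\<close>)

section \<open>The Potts partition function as a state sum\<close>

lemma partition_function_state_sum:
  assumes "finite_graph G"
  shows "partition_function q \<beta> J B G =
    state_sum q (exp (\<beta> * J) - 1) (\<lambda>\<alpha>. exp (\<beta> * B \<alpha>)) G (\<lambda>_. 1)"
  unfolding partition_function_def state_sum_def
proof (rule sum.cong)
  fix \<sigma>
  assume \<sigma>: "\<sigma> \<in> states q G"
  have fin: "finite (verts G)" "finite (edges G)"
    using assms by (auto simp: finite_graph_def)
  \<comment> \<open>\<open>\<sigma> v\<close> lies in \<open>{1..q}\<close>, so exactly one term of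
    the Kronecker sum survives.\<close>
  have "(\<Sum>\<alpha>=1..q. B \<alpha> * of_bool (\<alpha> = \<sigma> v)) = B (\<sigma> v)" if "v \<in> verts G" for v
  proof -
    have "\<sigma> v \<in> {1..q}" using \<sigma> that by (auto simp: states_def)
    then show ?thesis by (simp add: of_bool_def if_distrib cong: if_cong)
  qed
  then have "- \<beta> * hamiltonian q J B G \<sigma> =
      (\<Sum>e\<in>edges G. \<beta> * J * edge_delta \<sigma> (ends G e)) + (\<Sum>v\<in>verts G. \<beta> * B (\<sigma> v))"
    by (simp add: hamiltonian_def sum_distrib_left[symmetric] algebra_simps)
  \<comment> \<open>The delta takes only the values 0 and 1, where the exponential agrees with this
    affine function.\<close>
  moreover have "exp (\<beta> * J * edge_delta \<sigma> a) = 1 + (exp (\<beta> * J) - 1) * edge_delta \<sigma> a" for a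
    by (simp add: edge_delta_def)
  ultimately show "exp (- \<beta> * hamiltonian q J B G \<sigma>) =
      state_weight (exp (\<beta> * J) - 1) (\<lambda>\<alpha>. exp (\<beta> * B \<alpha>)) G (\<lambda>_. 1) \<sigma>"
    by (simp add: state_weight_def exp_add exp_sum fin)
qed simp

theorem theorem5p2:
  fixes q :: nat and \<beta> J :: complex and B :: "nat \<Rightarrow> complex"
    and G :: "('v, 'e) multigraph"
  assumes "q \<ge> 1"
    and "exp (\<beta> * J) \<noteq> 1"
    and "finite_graph G"
  shows "partition_function q \<beta> J B G =
    (exp (\<beta> * J) - 1) ^ card (verts G) *
    eval_wpoly
      (\<lambda>k. 1 / (exp (\<beta> * J) - 1) * (\<Sum>\<alpha>=1..q. exp (\<beta> * of_nat k * B \<alpha>)))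
      (exp (\<beta> * J))
      (U_poly G)"
proof -
  have "exp (\<beta> * of_nat k * B \<alpha>) = exp (\<beta> * B \<alpha>) ^ k" for k \<alpha>
    by (simp add: exp_of_nat_mult[symmetric] mult_ac)
  then show ?thesis
    using state_sum_W_poly[of "exp (\<beta> * J) - 1" G q "\<lambda>\<alpha>. exp (\<beta> * B \<alpha>)" "\<lambda>_. 1"] assms
    by (simp add: partition_function_state_sum U_poly_def)
qed

end
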